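(* Let $\varphi:\mathbb R^+\to\mathbb R^+$ be an increasing function with $\varphi(n)/n\to\infty$ as $n\to\infty$, and let $$S(\varphi):=\left\{x\in\mathbb I:\lim_{n\to\infty}\frac{S_n(x)}{\varphi(n)}=1\right\}.$$ Then: (i) if for any $\varepsilon>0$ there exists $\delta>0$ such that for all large $n$, $$\log\varphi(n+\varepsilon\sqrt n)-\log\varphi(n)\ge\delta,$$ then $\dim_{\rm H}S(\varphi)\le 1/2$; (ii) if $$\limsup_{n\to\infty}\frac{\log\varphi(n)}n=\infty,$$ then $\dim_{\rm H}S(\varphi)\le1/2$.
   Context: $\mathbb R^+$ is the set of positive reals and $\mathbb I:=[0,1)\setminus\mathbb Q$. For $x\in\mathbb I$, $a_1(x),a_2(x),\dots$ are the coefficients (partial quotients, positive integers) of its continued fraction expansion $x=[a_1(x),a_2(x),\dots]=1/(a_1(x)+1/(a_2(x)+\cdots))$, and $S_n(x):=\sum_{k=1}^n a_k(x)$. $\dim_{\rm H}$ denotes Hausdorff dimension. The variable $n$ ranges over positive integers. *)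

theory Defs
  imports "HOL-Analysis.Analysis"
begin

section \<open>Hausdorff measure and dimension\<close>

(* The case split enforces the usual conventions |U|^0 = 1 for nonempty U (whereas
   0 powr 0 = 0 in HOL) and |{}|^s = 0. *)
definition diameter_power :: "real \<Rightarrow> 'a::metric_space set \<Rightarrow> real" where
  "diameter_power s U = (if U = {} then 0 else if s = 0 then 1 else diameter U powr s)"

(* Boundedness is explicit because the real-valued diameter of an unbounded set is unspecified.
   Members of a cover may be empty, so finite covers are included. *)
definition delta_covers :: "real \<Rightarrow> 'a::metric_space set \<Rightarrow> (nat \<Rightarrow> 'a set) set" where
  "delta_covers \<delta> A = {U. A \<subseteq> (\<Union>i. U i) \<and> (\<forall>i. bounded (U i) \<and> diameter (U i) \<le> \<delta>)}"

definition hausdorff_premeasure :: "real \<Rightarrow> real \<Rightarrow> 'a::metric_space set \<Rightarrow> ennreal" where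
  "hausdorff_premeasure s \<delta> A = (INF U \<in> delta_covers \<delta> A. \<Sum>i. ennreal (diameter_power s (U i)))"

definition hausdorff_measure :: "real \<Rightarrow> 'a::metric_space set \<Rightarrow> ennreal" where
  "hausdorff_measure s A = (SUP \<delta> \<in> {0<..}. hausdorff_premeasure s \<delta> A)"

definition hausdorff_dim :: "'a::metric_space set \<Rightarrow> ereal" where
  "hausdorff_dim A = (INF s \<in> {s. 0 \<le> s \<and> hausdorff_measure s A = 0}. ereal s)"


section \<open>Continued fraction coefficients\<close>

definition irrational_unit :: "real set" where
  "irrational_unit = {0..<1} - \<rat>"

definition gauss_map :: "real \<Rightarrow> real" where
  "gauss_map x = frac (1 / x)"

(* Indexing starts at 1; the value at index 0 is meaningless.  That these numbers are exactly the
   coefficients of the expansion of x is the lemma cf_coeff_iff below. *)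
definition cf_coeff :: "nat \<Rightarrow> real \<Rightarrow> int" where
  "cf_coeff k x = \<lfloor>1 / (gauss_map ^^ (k - 1)) x\<rfloor>"

definition cf_sum :: "nat \<Rightarrow> real \<Rightarrow> int" where
  "cf_sum n x = (\<Sum>k = 1..n. cf_coeff k x)"

definition cf_sum_asymp_set :: "(real \<Rightarrow> real) \<Rightarrow> real set" where
  "cf_sum_asymp_set \<phi> =
     {x \<in> irrational_unit. (\<lambda>n. real_of_int (cf_sum n x) / \<phi> (real n)) \<longlonglongrightarrow> 1}"


subsection \<open>The coefficients are those of the continued fraction expansion\<close>

(* cf_eval a n t = 1/(a 1 + 1/(a 2 + ... + 1/(a n + t))); t = 0 gives the n-th convergent. *)
primrec cf_eval :: "(nat \<Rightarrow> int) \<Rightarrow> nat \<Rightarrow> real \<Rightarrow> real" where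
  "cf_eval a 0 t = t"
| "cf_eval a (Suc n) t = 1 / (real_of_int (a 1) + cf_eval (\<lambda>k. a (Suc k)) n t)"

lemma cf_eval_cong:
  assumes "\<And>k. k \<ge> 1 \<Longrightarrow> a k = b k"
  shows "cf_eval a n t = cf_eval b n t"
  using assms
proof (induction n arbitrary: a b)
  case (Suc n)
  have "cf_eval (\<lambda>k. a (Suc k)) n t = cf_eval (\<lambda>k. b (Suc k)) n t"
    by (rule Suc.IH) (simp add: Suc.prems)
  then show ?case by (simp add: Suc.prems)
qed simp

lemma cf_eval_range:
  assumes "\<And>k. k \<ge> 1 \<Longrightarrow> a k \<ge> 1" "0 \<le> t" "t \<le> 1"
  shows "0 \<le> cf_eval a n t \<and> cf_eval a n t \<le> 1"
  using assms(1)
proof (induction n arbitrary: a)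
  case 0
  then show ?case using assms by simp
next
  case (Suc n)
  have "0 \<le> cf_eval (\<lambda>k. a (Suc k)) n t"
    using Suc.IH[of "\<lambda>k. a (Suc k)"] Suc.prems by simp
  moreover have "real_of_int (a 1) \<ge> 1" using Suc.prems[of 1] by simp
  ultimately show ?case by (simp add: field_simps)
qed

lemma two_step_contraction:
  fixes a b s t :: real
  assumes "1 \<le> a" "1 \<le> b" "0 \<le> s" "0 \<le> t"
  shows "\<bar>1 / (a + 1 / (b + s)) - 1 / (a + 1 / (b + t))\<bar> \<le> \<bar>s - t\<bar> / 4"
proof -
  let ?p = "a * (b + s) + 1" and ?q = "a * (b + t) + 1"
  have p: "?p \<ge> 2" and q: "?q \<ge> 2"
    using assms mult_mono[of 1 a 1 "b + s"] mult_mono[of 1 a 1 "b + t"] by auto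
  have e: "1 / (a + 1 / (b + s)) = (b + s) / ?p" "1 / (a + 1 / (b + t)) = (b + t) / ?q"
    using assms by (simp_all add: divide_simps)
  have "(b + s) / ?p - (b + t) / ?q = ((b + s) * ?q - (b + t) * ?p) / (?p * ?q)"
    using p q by (intro diff_frac_eq) auto
  also have "(b + s) * ?q - (b + t) * ?p = s - t"
    by (simp add: algebra_simps)
  finally have d: "(b + s) / ?p - (b + t) / ?q = (s - t) / (?p * ?q)" .
  have pq: "4 \<le> ?p * ?q"
    using mult_mono[OF p q] p by simp
  then have "\<bar>s - t\<bar> / (?p * ?q) \<le> \<bar>s - t\<bar> / 4"
    by (intro divide_left_mono) auto
  moreover have "\<bar>(s - t) / (?p * ?q)\<bar> = \<bar>s - t\<bar> / (?p * ?q)"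
    using pq by (simp only: abs_divide)
  ultimately show ?thesis unfolding e d by linarith
qed

lemma cf_eval_contract:
  assumes "\<And>k. k \<ge> 1 \<Longrightarrow> a k \<ge> 1" "0 \<le> s" "s \<le> 1" "0 \<le> t" "t \<le> 1"
  shows "\<bar>cf_eval a n s - cf_eval a n t\<bar> \<le> 2 * (1 / 2) ^ n"
  using assms(1)
proof (induction n arbitrary: a rule: induct_nat_012)
  case 0
  then show ?case using assms by simp
next
  case 1
  have "0 \<le> cf_eval a (Suc 0) s \<and> cf_eval a (Suc 0) s \<le> 1"
    "0 \<le> cf_eval a (Suc 0) t \<and> cf_eval a (Suc 0) t \<le> 1"
    by (intro cf_eval_range 1 assms; assumption)+
  then show ?case by (simp add: abs_le_iff del: cf_eval.simps)
next
  case (ge2 n)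
  let ?b = "\<lambda>k. a (Suc (Suc k))"
  have b: "\<And>k. k \<ge> 1 \<Longrightarrow> ?b k \<ge> 1" by (simp add: ge2.prems)
  have ge: "real_of_int (a 1) \<ge> 1" "real_of_int (a 2) \<ge> 1"
    using ge2.prems[of 1] ge2.prems[of 2] by auto
  have "\<bar>cf_eval a (Suc (Suc n)) s - cf_eval a (Suc (Suc n)) t\<bar>
        \<le> \<bar>cf_eval ?b n s - cf_eval ?b n t\<bar> / 4"
    using two_step_contraction[OF ge, of "cf_eval ?b n s" "cf_eval ?b n t"]
      cf_eval_range[of ?b s n] cf_eval_range[of ?b t n] b assms
    by (simp add: numeral_2_eq_2)
  also have "\<dots> \<le> 2 * (1 / 2) ^ n / 4"
    by (intro divide_right_mono ge2.IH(1) b) auto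
  finally show ?case by simp
qed

lemma irrational_unitD:
  assumes "x \<in> irrational_unit"
  shows "0 < x" "x < 1" "x \<notin> \<rat>"
  using assms by (auto simp: irrational_unit_def order_less_le)

lemma gauss_map_irrational_unit:
  assumes "x \<in> irrational_unit"
  shows "gauss_map x \<in> irrational_unit"
proof -
  have "gauss_map x \<notin> \<rat>"
  proof
    assume "gauss_map x \<in> \<rat>"
    then have "gauss_map x + of_int \<lfloor>1 / x\<rfloor> \<in> \<rat>" by (intro Rats_add) auto
    then have "1 / x \<in> \<rat>" by (simp add: gauss_map_def frac_def)
    then have "1 / (1 / x) \<in> \<rat>" by (rule Rats_divide[OF Rats_1])
    then show False using irrational_unitD[OF assms] by simp
  qed
  then show ?thesis by (simp add: irrational_unit_def gauss_map_def frac_lt_1)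
qed

lemma funpow_gauss_map_irrational_unit:
  "x \<in> irrational_unit \<Longrightarrow> (gauss_map ^^ n) x \<in> irrational_unit"
  by (induction n) (auto intro: gauss_map_irrational_unit)

lemma cf_coeff_1: "cf_coeff 1 x = \<lfloor>1 / x\<rfloor>"
  by (simp add: cf_coeff_def)

lemma cf_coeff_Suc: "k \<ge> 1 \<Longrightarrow> cf_coeff (Suc k) x = cf_coeff k (gauss_map x)"
  by (cases k) (simp_all add: cf_coeff_def funpow_Suc_right del: funpow.simps)

lemma cf_coeff_pos:
  assumes "x \<in> irrational_unit"
  shows "cf_coeff k x \<ge> 1"
  using irrational_unitD[OF funpow_gauss_map_irrational_unit[OF assms, of "k - 1"]]
  by (simp add: cf_coeff_def le_floor_iff)

lemma cf_eval_cf_coeff: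
  "x \<in> irrational_unit \<Longrightarrow> cf_eval (\<lambda>k. cf_coeff k x) n ((gauss_map ^^ n) x) = x"
proof (induction n arbitrary: x)
  case (Suc n)
  have "cf_eval (\<lambda>k. cf_coeff (Suc k) x) n ((gauss_map ^^ Suc n) x)
      = cf_eval (\<lambda>k. cf_coeff k (gauss_map x)) n ((gauss_map ^^ n) (gauss_map x))"
    unfolding funpow_Suc_right comp_def by (rule cf_eval_cong) (rule cf_coeff_Suc)
  also have "\<dots> = gauss_map x"
    by (rule Suc.IH[OF gauss_map_irrational_unit[OF Suc.prems]])
  finally have "cf_eval (\<lambda>k. cf_coeff k x) (Suc n) ((gauss_map ^^ Suc n) x)
      = 1 / (of_int \<lfloor>1 / x\<rfloor> + gauss_map x)"
    by (simp only: cf_eval.simps cf_coeff_1)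
  also have "\<dots> = x" by (simp add: gauss_map_def frac_def)
  finally show ?case .
qed simp

lemma cf_eval_tendsto:
  assumes "x \<in> irrational_unit"
  shows "(\<lambda>n. cf_eval (\<lambda>k. cf_coeff k x) n 0) \<longlonglongrightarrow> x"
proof -
  have "norm (cf_eval (\<lambda>k. cf_coeff k x) n 0 - x) \<le> 2 * (1 / 2) ^ n" for n
    using cf_eval_contract[of "\<lambda>k. cf_coeff k x" 0 "(gauss_map ^^ n) x" n]
      cf_coeff_pos[OF assms] irrational_unitD[OF funpow_gauss_map_irrational_unit[OF assms, of n]]
    by (simp add: cf_eval_cf_coeff[OF assms])
  then have bound: "\<forall>\<^sub>F n in sequentially.
      norm (cf_eval (\<lambda>k. cf_coeff k x) n 0 - x) \<le> 2 * (1 / 2) ^ n"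
    by (rule always_eventually[OF allI])
  have "(\<lambda>n. 2 * (1 / 2) ^ n :: real) \<longlonglongrightarrow> 0"
    by (intro tendsto_mult_right_zero LIMSEQ_power_zero) simp
  with bound have "(\<lambda>n. cf_eval (\<lambda>k. cf_coeff k x) n 0 - x) \<longlonglongrightarrow> 0"
    by (rule Lim_null_comparison)
  then show ?thesis by (rule LIM_zero_cancel)
qed

lemma cf_expansion_unique:
  assumes "x \<in> irrational_unit" "\<And>k. k \<ge> 1 \<Longrightarrow> a k \<ge> 1"
    and "(\<lambda>n. cf_eval a n 0) \<longlonglongrightarrow> x" "k \<ge> 1"
  shows "a k = cf_coeff k x"
  using assms
proof (induction k arbitrary: a x)
  case (Suc k)
  let ?b = "\<lambda>k. a (Suc k)" and ?y = "1 / x - of_int (a 1)"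
  note x = irrational_unitD[OF Suc.prems(1)]
  have b: "\<And>k. k \<ge> 1 \<Longrightarrow> ?b k \<ge> 1" by (simp add: Suc.prems(2))
  have "(\<lambda>n. cf_eval a (Suc n) 0) \<longlonglongrightarrow> x"
    using Suc.prems(3) by (rule LIMSEQ_Suc)
  then have "(\<lambda>n. 1 / cf_eval a (Suc n) 0 - of_int (a 1)) \<longlonglongrightarrow> ?y"
    using x by (intro tendsto_intros) auto
  then have lim: "(\<lambda>n. cf_eval ?b n 0) \<longlonglongrightarrow> ?y" by simp
  have "0 \<le> ?y"
    by (rule LIMSEQ_le_const[OF lim]) (use cf_eval_range[of ?b 0] b in auto)
  moreover have "?y \<le> 1"
    by (rule LIMSEQ_le_const2[OF lim]) (use cf_eval_range[of ?b 0] b in auto)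
  moreover have "?y \<notin> \<rat>"
  proof
    assume "?y \<in> \<rat>"
    then have "?y + of_int (a 1) \<in> \<rat>" by (intro Rats_add) auto
    then have "1 / x \<in> \<rat>" by simp
    then have "1 / (1 / x) \<in> \<rat>" by (rule Rats_divide[OF Rats_1])
    then show False using x by simp
  qed
  then have "?y \<noteq> 1" by (metis Rats_1)
  ultimately have y: "0 \<le> ?y" "?y < 1" by auto
  then have a1: "\<lfloor>1 / x\<rfloor> = a 1" by (simp add: floor_eq_iff)
  then have g: "gauss_map x = ?y" by (simp add: gauss_map_def frac_def)
  show ?case
  proof (cases "k = 0")
    case True
    then show ?thesis using a1 cf_coeff_1[of x] by simp
  next
    case False
    then have "?b k = cf_coeff k (gauss_map x)"
      by (intro Suc.IH gauss_map_irrational_unit[OF Suc.prems(1)] b) (use lim g in auto)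
    then show ?thesis using False by (simp add: cf_coeff_Suc)
  qed
qed simp

lemma cf_coeff_iff:
  assumes "x \<in> irrational_unit"
  shows "(\<forall>k\<ge>1. a k = cf_coeff k x) \<longleftrightarrow>
         (\<forall>k\<ge>1. a k \<ge> 1) \<and> (\<lambda>n. cf_eval a n 0) \<longlonglongrightarrow> x"
proof
  assume eq: "\<forall>k\<ge>1. a k = cf_coeff k x"
  then have "(\<lambda>n. cf_eval a n 0) = (\<lambda>n. cf_eval (\<lambda>k. cf_coeff k x) n 0)"
    by (intro ext cf_eval_cong) simp
  then show "(\<forall>k\<ge>1. a k \<ge> 1) \<and> (\<lambda>n. cf_eval a n 0) \<longlonglongrightarrow> x"
    using eq cf_coeff_pos[OF assms] cf_eval_tendsto[OF assms] by simp
next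
  assume "(\<forall>k\<ge>1. a k \<ge> 1) \<and> (\<lambda>n. cf_eval a n 0) \<longlonglongrightarrow> x"
  then show "\<forall>k\<ge>1. a k = cf_coeff k x"
    using cf_expansion_unique[OF assms] by blast
qed

end

theory Submission
  imports Defs
begin

text \<open>
  Both parts follow from one principle: if, for every \<open>L\<close>, each point of a set satisfies
  \<open>a\<^sub>1 \<cdots> a\<^sub>n \<ge> L\<^sup>n\<close> for infinitely many \<open>n\<close>, then the set has dimension at most \<open>1/2\<close>
  (\<open>hausdorff_dim_le_half\<close>).  Indeed, a cylinder with coefficients \<open>w\<^sub>1, \<dots>, w\<^sub>n\<close> has diameter at
  most \<open>(w\<^sub>1 \<cdots> w\<^sub>n)\<^sup>-\<^sup>2\<close>.  For \<open>s > 1/2\<close> write \<open>2s = t + \<eta>\<close> with \<open>t > 1\<close> and \<open>\<eta> > 0\<close>.  The \<open>s\<close>-th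
  power of the diameter of a cylinder with \<open>w\<^sub>1 \<cdots> w\<^sub>n \<ge> L\<^sup>n\<close> is then at most the product of the
  weights \<open>L powr (-\<eta>) * w\<^sub>i powr (-t)\<close>.  The sum of such products over all words of length \<open>n\<close>
  factorises as \<open>(L powr (-\<eta>) * \<zeta>(t))\<^sup>n\<close>, which is at most \<open>2\<^sup>-\<^sup>n\<close> once \<open>L\<close> is large.  For every
  \<open>N\<close> these cylinders with \<open>n \<ge> N\<close> cover the set, and the tails of the geometric series tend to \<open>0\<close>,
  as in the Borel--Cantelli lemma.

  It remains to pass from sums to products.  As \<open>l\<close> numbers that are at least \<open>1\<close> have a
  sum of at most \<open>2\<^sup>l\<close> times their product (\<open>sum_le_2_power_card_mult_prod\<close>), large sums over few
  coefficients force large products.  For part (ii) this is applied to the first \<open>n\<close>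
  coefficients: the product is at least about \<open>\<phi>(n) / 2\<^sup>n\<close>, and \<open>\<phi>(n)\<close> beats every \<open>C\<^sup>n\<close>
  infinitely often (\<open>large_products_if_superexponential\<close>).

  For part (i) it is applied to windows.  The hypothesis with \<open>\<epsilon> = 1\<close> yields a constant \<open>d\<close> such
  that \<open>\<phi>(m\<^sup>2)\<close> grows at least like \<open>exp(dm)\<close>.  With \<open>\<epsilon> = 1/K\<close> it shows that, for \<open>n\<close> of the order
  \<open>m\<^sup>2\<close>, the sum over each window of length about \<open>m/K\<close> is at least a constant times \<open>\<phi>(m\<^sup>2)\<close>.
  There are about \<open>Km\<close> disjoint windows, each contributing a factor of about \<open>exp(dm)\<close> up to a
  factor \<open>2\<close> per coefficient.  The logarithm of the product thus exceeds a constant times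
  \<open>(Kd - O(1)) m\<^sup>2\<close>.  What makes this work is that \<open>d\<close> does not depend on \<open>K\<close>, so that \<open>K\<close> can be
  taken as large as needed (\<open>large_products_if_sqrt_growth\<close>).
\<close>

section \<open>Hausdorff null sets\<close>

text \<open>
  For \<open>s > 0\<close> the diameter of each covering set is controlled by the sum of all the \<open>s\<close>-th powers,
  so a cover with a small enough sum is automatically a \<open>\<delta>\<close>-cover.
\<close>
lemma hausdorff_measure_eq_0I:
  fixes A :: "'a::metric_space set"
  assumes "s > 0"
    and cover: "\<And>e. e > 0 \<Longrightarrow> \<exists>U. A \<subseteq> (\<Union>i. U i) \<and> (\<forall>i. bounded (U i)) \<and>
           (\<Sum>i::nat. ennreal (diameter_power s (U i))) \<le> ennreal e"
  shows "hausdorff_measure s A = 0"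
proof -
  have "hausdorff_premeasure s \<delta> A \<le> 0" if \<delta>: "\<delta> > 0" for \<delta>
  proof (rule ennreal_le_epsilon)
    fix e :: real assume e: "e > 0"
    define e' where "e' = min e (\<delta> powr s)"
    have "e' > 0" using e \<delta> by (simp add: e'_def)
    from cover[OF this] obtain U where U: "A \<subseteq> (\<Union>i. U i)" "\<forall>i. bounded (U i)"
      and sum: "(\<Sum>i. ennreal (diameter_power s (U i))) \<le> ennreal e'" by blast
    have "diameter (U i) \<le> \<delta>" for i
    proof (cases "U i = {}")
      case False
      have "ennreal (diameter_power s (U i)) \<le> (\<Sum>i. ennreal (diameter_power s (U i)))"
        using sum_le_suminf[of "\<lambda>i. ennreal (diameter_power s (U i))" "{i}"] by simp
      then have "ennreal (diameter_power s (U i)) \<le> ennreal e'" using sum by order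
      then have "diameter_power s (U i) \<le> e'" using \<open>e' > 0\<close> by (simp add: ennreal_le_iff)
      then have "diameter (U i) powr s \<le> \<delta> powr s"
        using False \<open>s > 0\<close> by (simp add: diameter_power_def e'_def)
      then show ?thesis
        using \<open>s > 0\<close> \<delta> by (meson less_eq_real_def not_le powr_less_mono2)
    qed (use \<delta> in simp)
    then have "U \<in> delta_covers \<delta> A" using U by (simp add: delta_covers_def)
    then have "hausdorff_premeasure s \<delta> A \<le> (\<Sum>i. ennreal (diameter_power s (U i)))"
      unfolding hausdorff_premeasure_def by (rule INF_lower)
    also have "\<dots> \<le> ennreal e'" by (rule sum)
    also have "\<dots> \<le> 0 + ennreal e" by (simp add: e'_def ennreal_leI)
    finally show "hausdorff_premeasure s \<delta> A \<le> 0 + ennreal e" .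
  qed
  then show ?thesis by (auto simp: hausdorff_measure_def intro!: antisym SUP_least)
qed

text \<open>
  This form takes covers indexed by a countable type, such as words, and bounds only finite partial
  sums.  It reduces to sequences by placing the empty set, of diameter power \<open>0\<close>, at the numbers
  that encode no index.
\<close>
lemma hausdorff_measure_eq_0I_countable:
  fixes A :: "'a::metric_space set"
  assumes "s > 0"
    and cover: "\<And>e. e > 0 \<Longrightarrow> \<exists>(I :: 'i::countable set) U. A \<subseteq> (\<Union>i\<in>I. U i) \<and> (\<forall>i\<in>I. bounded (U i)) \<and>
           (\<forall>F. finite F \<longrightarrow> F \<subseteq> I \<longrightarrow> (\<Sum>i\<in>F. diameter_power s (U i)) \<le> e)"
  shows "hausdorff_measure s A = 0"
proof (rule hausdorff_measure_eq_0I[OF \<open>s > 0\<close>])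
  fix e :: real assume "e > 0"
  from cover[OF this] obtain I :: "'i set" and U where A: "A \<subseteq> (\<Union>i\<in>I. U i)"
    and bdd: "\<And>i. i \<in> I \<Longrightarrow> bounded (U i)"
    and sum: "\<And>F. finite F \<Longrightarrow> F \<subseteq> I \<Longrightarrow> (\<Sum>i\<in>F. diameter_power s (U i)) \<le> e" by blast
  define V where "V n = (if n \<in> to_nat ` I then U (from_nat n) else {})" for n
  have dp0: "diameter_power s B \<ge> 0" for B :: "'a set" by (simp add: diameter_power_def)
  have "(\<Sum>n<m. ennreal (diameter_power s (V n))) \<le> ennreal e" for m
  proof -
    let ?F = "{i \<in> I. to_nat i < m}"
    have fin: "finite ?F"
      by (rule finite_imageD[of to_nat]) (auto intro: finite_subset[of _ "{..<m}"] inj_onI)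
    have "(\<Sum>n<m. diameter_power s (V n)) = (\<Sum>n\<in>to_nat ` ?F. diameter_power s (V n))"
      by (rule sum.mono_neutral_right) (auto simp: V_def diameter_power_def)
    also have "\<dots> = (\<Sum>i\<in>?F. diameter_power s (V (to_nat i)))"
      by (rule sum.reindex_cong[of to_nat]) (auto intro: inj_onI)
    also have "\<dots> = (\<Sum>i\<in>?F. diameter_power s (U i))"
      by (rule sum.cong) (auto simp: V_def)
    also have "\<dots> \<le> e" using fin by (rule sum) auto
    finally show ?thesis using dp0 by (simp add: sum_ennreal ennreal_leI)
  qed
  then have "(\<Sum>n. ennreal (diameter_power s (V n))) \<le> ennreal e"
    by (intro suminf_le_const) auto
  moreover have "A \<subseteq> (\<Union>n. V n)"
  proof
    fix x assume "x \<in> A"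
    then obtain i where "i \<in> I" "x \<in> U i" using A by blast
    then have "x \<in> V (to_nat i)" by (simp add: V_def)
    then show "x \<in> (\<Union>n. V n)" by blast
  qed
  moreover have "\<forall>n. bounded (V n)" using bdd by (auto simp: V_def)
  ultimately show "\<exists>V. A \<subseteq> (\<Union>n. V n) \<and> (\<forall>n. bounded (V n)) \<and>
      (\<Sum>n::nat. ennreal (diameter_power s (V n))) \<le> ennreal e" by blast
qed

section \<open>Cylinders\<close>

definition cf_word :: "nat \<Rightarrow> real \<Rightarrow> nat list" where
  "cf_word n x = map (\<lambda>k. nat (cf_coeff k x)) [1..<Suc n]"

definition cf_cylinder :: "nat list \<Rightarrow> real set" where
  "cf_cylinder w = {x \<in> irrational_unit. cf_word (length w) x = w}"

lemma length_cf_word [simp]: "length (cf_word n x) = n"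
  by (simp add: cf_word_def)

lemma cf_word_Suc: "cf_word (Suc n) x = nat \<lfloor>1 / x\<rfloor> # cf_word n (gauss_map x)"
proof -
  have "[1..<Suc (Suc n)] = 1 # map Suc [1..<Suc n]"
    by (simp add: map_Suc_upt upt_conv_Cons del: upt_Suc)
  then show ?thesis
    by (simp add: cf_word_def cf_coeff_1[simplified] cf_coeff_Suc del: upt_Suc)
qed

lemma prod_list_cf_word:
  "x \<in> irrational_unit \<Longrightarrow> real (prod_list (cf_word n x)) = (\<Prod>k=1..n. real_of_int (cf_coeff k x))"
proof (induction n)
  case (Suc n)
  have "cf_coeff (Suc n) x \<ge> 0" using cf_coeff_pos[OF Suc.prems, of "Suc n"] by simp
  then show ?case using Suc by (simp add: cf_word_def)
qed (simp add: cf_word_def)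

text \<open>
  Each step of the expansion applies a branch \<open>u \<mapsto> 1 / (a + u)\<close>, which contracts distances on
  \<open>[0, \<infinity>)\<close> by a factor of at least \<open>a\<^sup>2\<close>; the contractions multiply along the word.
\<close>
lemma dist_in_cf_cylinder:
  assumes "x \<in> irrational_unit" "y \<in> irrational_unit" "cf_word n x = cf_word n y"
  shows "\<bar>x - y\<bar> \<le> 1 / (real (prod_list (cf_word n x)))\<^sup>2"
  using assms
proof (induction n arbitrary: x y)
  case 0
  then show ?case using irrational_unitD[of x] irrational_unitD[of y] by (simp add: cf_word_def abs_le_iff)
next
  case (Suc n)
  let ?a = "real (nat \<lfloor>1 / x\<rfloor>)" and ?u = "gauss_map x" and ?v = "gauss_map y"
  let ?p = "real (prod_list (cf_word n ?u))"
  have floor_pos: "\<lfloor>1 / z\<rfloor> \<ge> 1" if "z \<in> irrational_unit" for z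
    using cf_coeff_pos[OF that, of 1] by (simp only: cf_coeff_1)
  have eq: "nat \<lfloor>1 / x\<rfloor> = nat \<lfloor>1 / y\<rfloor>" "cf_word n ?u = cf_word n ?v"
    using Suc.prems(3) by (simp_all add: cf_word_Suc)
  have a: "?a \<ge> 1" using floor_pos[OF Suc.prems(1)] by linarith
  have G: "?u \<in> irrational_unit" "?v \<in> irrational_unit"
    using Suc.prems gauss_map_irrational_unit by auto
  note uv = irrational_unitD[OF G(1)] irrational_unitD[OF G(2)]
  have "real (nat \<lfloor>1 / z\<rfloor>) + gauss_map z = 1 / z" if "z \<in> irrational_unit" for z
  proof -
    have "real (nat \<lfloor>1 / z\<rfloor>) = of_int \<lfloor>1 / z\<rfloor>"
      by (intro of_nat_nat order.trans[OF zero_le_one floor_pos[OF that]])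
    then show ?thesis by (simp add: gauss_map_def frac_def)
  qed
  note expand = this[OF Suc.prems(1)] this[OF Suc.prems(2)]
  have "1 / x = ?a + ?u" using expand by simp
  then have x: "x = 1 / (?a + ?u)" by (metis div_by_1 divide_divide_eq_right mult_1)
  have "1 / y = ?a + ?v" using expand eq(1) by simp
  then have y: "y = 1 / (?a + ?v)" by (metis div_by_1 divide_divide_eq_right mult_1)
  have den: "?a\<^sup>2 \<le> (?a + ?u) * (?a + ?v)"
    unfolding power2_eq_square using a uv by (intro mult_mono) auto
  have "1 / (?a + ?u) - 1 / (?a + ?v) = (?v - ?u) / ((?a + ?u) * (?a + ?v))"
    using a uv by (subst diff_frac_eq) auto
  then have "x - y = (?v - ?u) / ((?a + ?u) * (?a + ?v))"
    using x y by argo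
  then have "\<bar>x - y\<bar> = \<bar>?u - ?v\<bar> / ((?a + ?u) * (?a + ?v))"
    using a uv by (simp add: abs_mult abs_minus_commute)
  also have "\<dots> \<le> \<bar>?u - ?v\<bar> / ?a\<^sup>2"
  proof (rule divide_left_mono[OF den])
    have "?a + ?u > 0" "?a + ?v > 0" "?a\<^sup>2 > 0" using a uv by (auto intro: add_pos_pos)
    then show "0 < ((?a + ?u) * (?a + ?v)) * ?a\<^sup>2" by (intro mult_pos_pos)
  qed simp
  also have "\<dots> \<le> (1 / ?p\<^sup>2) / ?a\<^sup>2"
    by (intro divide_right_mono Suc.IH G eq(2)) auto
  also have "\<dots> = 1 / (real (prod_list (cf_word (Suc n) x)))\<^sup>2"
    by (simp add: cf_word_Suc power_mult_distrib mult.commute)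
  finally show ?case .
qed

lemma prod_list_cf_word_pos:
  assumes "x \<in> irrational_unit" shows "prod_list (cf_word n x) > 0"
proof -
  have "1 \<le> nat (cf_coeff k x)" for k using cf_coeff_pos[OF assms, of k] by simp
  then have "\<forall>a\<in>set (cf_word n x). 1 \<le> a" unfolding cf_word_def set_map by blast
  then have "0 \<notin> set (cf_word n x)" by force
  then show ?thesis by (simp add: prod_list_zero_iff flip: neq0_conv)
qed

lemma bounded_cf_cylinder: "bounded (cf_cylinder w)"
  by (rule bounded_subset[of "{0..1}"]) (auto simp: cf_cylinder_def irrational_unit_def)

lemma diameter_power_cf_cylinder_le:
  assumes "s > 0"
  shows "diameter_power s (cf_cylinder w) \<le> real (prod_list w) powr (- 2 * s)"
proof (cases "cf_cylinder w = {}")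
  case False
  then obtain x where x: "x \<in> irrational_unit" "cf_word (length w) x = w"
    by (auto simp: cf_cylinder_def)
  let ?p = "real (prod_list w)"
  have p: "?p > 0" using prod_list_cf_word_pos[OF x(1), of "length w"] x(2) by simp
  have "diameter (cf_cylinder w) \<le> 1 / ?p\<^sup>2"
  proof (rule diameter_le)
    fix y z assume "y \<in> cf_cylinder w" "z \<in> cf_cylinder w"
    then show "norm (y - z) \<le> 1 / ?p\<^sup>2"
      using dist_in_cf_cylinder[of y z "length w"] by (simp add: cf_cylinder_def)
  qed simp
  then have "diameter (cf_cylinder w) powr s \<le> (1 / ?p\<^sup>2) powr s"
    using assms by (intro powr_mono2 diameter_ge_0 bounded_cf_cylinder) auto
  also have "1 / ?p\<^sup>2 = ?p powr (-2)" using p by (simp add: powr_minus_divide)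
  finally show ?thesis using False assms by (simp add: diameter_power_def powr_powr)
qed (simp add: diameter_power_def)

section \<open>Summing over words\<close>

lemma sum_prod_list_words:
  fixes g :: "'a \<Rightarrow> 'b::comm_semiring_1"
  shows "(\<Sum>w | set w \<subseteq> S \<and> length w = n. prod_list (map g w)) = (\<Sum>a\<in>S. g a) ^ n"
proof (induction n)
  case 0
  have "{w. set w \<subseteq> S \<and> length w = 0} = {[]}" by auto
  then show ?case by simp
next
  case (Suc n)
  let ?W = "\<lambda>n. {w. set w \<subseteq> S \<and> length w = n}"
  have "(\<Sum>w\<in>?W (Suc n). prod_list (map g w)) = (\<Sum>(w, a)\<in>?W n \<times> S. prod_list (map g (a # w)))"
    unfolding lists_length_Suc_eq
    by (subst sum.reindex) (auto simp: inj_on_def case_prod_unfold)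
  also have "\<dots> = (\<Sum>w\<in>?W n. prod_list (map g w)) * (\<Sum>a\<in>S. g a)"
    unfolding sum_product sum.cartesian_product by (simp add: mult.commute case_prod_unfold)
  finally show ?case using Suc by (simp add: mult.commute)
qed

text \<open>
  A finite set of words uses only finitely many letters and lengths, so its sum is at most a
  finite sum of powers of the total weight \<open>\<Sum>a<B. g a\<close>, hence at most a tail of \<open>\<Sum>n. (1 / 2)\<^sup>n\<close>.
\<close>
lemma sum_prod_list_long_words_le:
  fixes g :: "nat \<Rightarrow> real"
  assumes g0: "\<And>a. g a \<ge> 0" and g1: "\<And>B. (\<Sum>a<B. g a) \<le> 1 / 2"
    and F: "finite F" "\<And>w. w \<in> F \<Longrightarrow> N \<le> length w"
  shows "(\<Sum>w\<in>F. prod_list (map g w)) \<le> 2 * (1 / 2) ^ N"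
proof -
  let ?W = "\<lambda>B n. {w. set w \<subseteq> {..<B} \<and> length w = n}"
  define B where "B = Suc (Max (insert 0 (\<Union>w\<in>F. set w)))"
  define M where "M = Suc (Max (insert 0 (length ` F)))"
  have fin: "finite (?W B n)" for n using finite_lists_length_eq[of "{..<B}" n] by simp
  have nonneg: "prod_list (map g w) \<ge> 0" for w using g0 by (induction w) auto
  have "F \<subseteq> (\<Union>n\<in>{N..<M}. ?W B n)"
  proof
    fix w assume w: "w \<in> F"
    have "a < B" if "a \<in> set w" for a
      unfolding B_def less_Suc_eq_le using w that F(1) by (intro Max_ge) auto
    moreover have "length w < M"
      unfolding M_def less_Suc_eq_le using w F(1) by (intro Max_ge) auto
    ultimately show "w \<in> (\<Union>n\<in>{N..<M}. ?W B n)" using F(2)[OF w] by auto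
  qed
  then have "(\<Sum>w\<in>F. prod_list (map g w)) \<le> (\<Sum>w\<in>(\<Union>n\<in>{N..<M}. ?W B n). prod_list (map g w))"
    using fin nonneg by (intro sum_mono2) auto
  also have "\<dots> = (\<Sum>n\<in>{N..<M}. \<Sum>w\<in>?W B n. prod_list (map g w))"
    using fin by (intro sum.UNION_disjoint) auto
  also have "\<dots> \<le> (\<Sum>n\<in>{N..<M}. (1 / 2) ^ n)"
    unfolding sum_prod_list_words using g0 g1 by (intro sum_mono power_mono) (auto intro: sum_nonneg)
  also have "\<dots> \<le> 2 * (1 / 2) ^ N"
  proof (cases "N \<le> M")
    case True
    then have "(\<Sum>n\<in>{N..<M}. (1 / 2) ^ n) = 2 * (1 / 2) ^ N - 2 * (1 / 2 :: real) ^ M"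
      by (induction rule: dec_induct) auto
    then show ?thesis by simp
  qed simp
  finally show ?thesis .
qed


section \<open>Large products of coefficients force dimension at most one half\<close>

text \<open>
  For \<open>s > 1/2\<close>, a fixed \<open>L\<close> depending on \<open>s\<close> is enough for the \<open>s\<close>-dimensional measure to vanish.
  The exponent \<open>1/2\<close> appears because \<open>\<Sum>a. a powr (- 2 * s)\<close> converges exactly for \<open>s > 1/2\<close>.
\<close>
lemma hausdorff_dim_le_half:
  assumes sub: "A \<subseteq> irrational_unit"
    and large: "\<And>x L. x \<in> A \<Longrightarrow> 1 \<le> L \<Longrightarrow>
      \<exists>\<^sub>F n in sequentially. L ^ n \<le> (\<Prod>k=1..n. real_of_int (cf_coeff k x))"
  shows "hausdorff_dim A \<le> ereal (1 / 2)"
proof -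
  have null: "hausdorff_measure s A = 0" if s: "s > 1 / 2" for s
  proof (rule hausdorff_measure_eq_0I_countable)
    show "s > 0" using s by simp
    fix e :: real assume e: "e > 0"
    (* In 2 * s = t + \<eta>, the exponent t > 1 keeps the sum over all coefficients finite, and the
       surplus \<eta> > 0 turns the size of the product into a gain L powr (- \<eta>) per letter. *)
    define t where "t = s + 1 / 2"
    define \<eta> where "\<eta> = s - 1 / 2"
    have t: "t > 1" and \<eta>: "\<eta> > 0" and split: "- 2 * s = - \<eta> + - t"
      using s by (auto simp: t_def \<eta>_def)
    define Z where "Z = (\<Sum>a. real a powr - t)"
    have summable: "summable (\<lambda>a. real a powr - t)"
      using t by (simp add: summable_real_powr_iff)
    have Z: "(\<Sum>a<B. real a powr - t) \<le> Z" for B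
      unfolding Z_def by (rule sum_le_suminf[OF summable]) auto
    have Z0: "Z \<ge> 0" using Z[of 0] by simp
    define L where "L = max 1 ((2 * Z) powr (1 / \<eta>))"
    have L: "L \<ge> 1" by (simp add: L_def)
    have "2 * Z = ((2 * Z) powr (1 / \<eta>)) powr \<eta>"
      using \<eta> Z0 by (simp add: powr_powr)
    also have "\<dots> \<le> L powr \<eta>" using \<eta> by (intro powr_mono2) (auto simp: L_def)
    finally have LZ: "L powr - \<eta> * Z \<le> 1 / 2"
      using L by (simp add: powr_minus field_simps)
    define g where "g a = L powr - \<eta> * real a powr - t" for a :: nat
    have g0: "g a \<ge> 0" for a by (simp add: g_def)
    have g1: "(\<Sum>a<B. g a) \<le> 1 / 2" for B
    proof -
      have "(\<Sum>a<B. g a) = L powr - \<eta> * (\<Sum>a<B. real a powr - t)"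
        by (simp add: g_def sum_distrib_left)
      also have "\<dots> \<le> L powr - \<eta> * Z" by (intro mult_left_mono Z) simp
      finally show ?thesis using LZ by linarith
    qed
    have prod_g: "prod_list (map g w) = (L powr - \<eta>) ^ length w * real (prod_list w) powr - t" for w
      by (induction w) (simp_all add: g_def powr_mult mult_ac)
    have "(\<lambda>N. 2 * (1 / 2) ^ N :: real) \<longlonglongrightarrow> 0"
      by (intro tendsto_mult_right_zero LIMSEQ_power_zero) simp
    then have "\<forall>\<^sub>F N in sequentially. 2 * (1 / 2) ^ N < e"
      using e by (rule order_tendstoD)
    then obtain N where N: "2 * (1 / 2) ^ N < e" by (auto simp: eventually_sequentially)
    define I where "I = {w. N \<le> length w \<and> L ^ length w \<le> real (prod_list w)}"
    have term_le: "diameter_power s (cf_cylinder w) \<le> prod_list (map g w)" if "w \<in> I" for w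
    proof -
      let ?p = "real (prod_list w)"
      have Lp: "L ^ length w \<le> ?p" using that by (simp add: I_def)
      have "?p powr - \<eta> \<le> (L ^ length w) powr - \<eta>"
        using Lp L \<eta> by (intro powr_mono2') auto
      also have "\<dots> = (L powr - \<eta>) ^ length w"
        using L by (simp add: powr_powr mult.commute flip: powr_realpow)
      finally have "?p powr (- 2 * s) \<le> (L powr - \<eta>) ^ length w * ?p powr - t"
        unfolding split powr_add by (intro mult_right_mono) auto
      then show ?thesis
        using diameter_power_cf_cylinder_le[of s w] s unfolding prod_g by simp
    qed
    have "A \<subseteq> (\<Union>w\<in>I. cf_cylinder w)"
    proof
      fix x assume x: "x \<in> A"
      with sub have xi: "x \<in> irrational_unit" by blast
      obtain n where n: "n \<ge> N" "L ^ n \<le> (\<Prod>k=1..n. real_of_int (cf_coeff k x))"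
        using large[OF x L] unfolding frequently_sequentially by blast
      then have "cf_word n x \<in> I" using prod_list_cf_word[OF xi, of n] by (simp add: I_def)
      moreover have "x \<in> cf_cylinder (cf_word n x)" using xi by (simp add: cf_cylinder_def)
      ultimately show "x \<in> (\<Union>w\<in>I. cf_cylinder w)" by blast
    qed
    moreover have "(\<Sum>w\<in>F. diameter_power s (cf_cylinder w)) \<le> e" if F: "finite F" "F \<subseteq> I" for F
    proof -
      have "(\<Sum>w\<in>F. diameter_power s (cf_cylinder w)) \<le> (\<Sum>w\<in>F. prod_list (map g w))"
        using F term_le by (intro sum_mono) auto
      also have "\<dots> \<le> 2 * (1 / 2) ^ N"
        using F g0 g1 by (intro sum_prod_list_long_words_le) (auto simp: I_def)
      finally show ?thesis using N by simp
    qed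
    ultimately show "\<exists>(I :: nat list set) U. A \<subseteq> (\<Union>w\<in>I. U w) \<and> (\<forall>w\<in>I. bounded (U w)) \<and>
        (\<forall>F. finite F \<longrightarrow> F \<subseteq> I \<longrightarrow> (\<Sum>w\<in>F. diameter_power s (U w)) \<le> e)"
      using bounded_cf_cylinder by blast
  qed
  show ?thesis
  proof (rule ereal_le_epsilon2)
    fix e :: real assume e: "0 < e"
    have "hausdorff_dim A \<le> ereal (1 / 2 + e)"
      unfolding hausdorff_dim_def by (rule INF_lower) (use e null[of "1 / 2 + e"] in simp)
    then show "hausdorff_dim A \<le> ereal (1 / 2) + ereal e" by simp
  qed
qed

section \<open>Sums and products of numbers that are at least one\<close>

text \<open>
  Each step uses \<open>x + y \<le> 2 * x * y\<close> for \<open>x, y \<ge> 1\<close>.  The factor \<open>2\<close> per summand is harmless, as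
  products are compared with \<open>L\<^sup>n\<close> for arbitrarily large \<open>L\<close>.
\<close>
lemma sum_le_2_power_card_mult_prod:
  fixes a :: "'a \<Rightarrow> real"
  assumes "finite F" "\<And>k. k \<in> F \<Longrightarrow> a k \<ge> 1"
  shows "sum a F \<le> 2 ^ card F * prod a F"
  using assms
proof (induction F)
  case (insert k F)
  let ?r = "2 ^ card F * prod a F"
  have "1 \<le> prod a F" using insert.prems by (intro prod_ge_1) auto
  then have r: "1 \<le> ?r" using mult_mono[of 1 "2 ^ card F" 1 "prod a F"] by simp
  have ak: "1 \<le> a k" using insert.prems by simp
  have "sum a (insert k F) \<le> a k + ?r" using insert by simp
  also have "\<dots> \<le> a k * ?r + a k * ?r"
    using ak r mult_mono[of 1 "a k" ?r ?r] mult_left_mono[of 1 ?r "a k"] by (intro add_mono) auto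
  also have "\<dots> = 2 ^ card (insert k F) * prod a (insert k F)" using insert by simp
  finally show ?case .
qed simp

text \<open>
  This is the previous inequality on the window \<open>{n<..n+l}\<close>, in a form that can be iterated over
  consecutive windows.
\<close>
lemma prod_mult_sum_diff_le:
  fixes a :: "nat \<Rightarrow> real"
  assumes "\<And>k. a k \<ge> 1"
  shows "(\<Prod>k=1..n. a k) * ((\<Sum>k=1..n+l. a k) - (\<Sum>k=1..n. a k)) \<le> 2 ^ l * (\<Prod>k=1..n+l. a k)"
proof -
  have un: "{1..n+l} = {1..n} \<union> {n<..n+l}" by auto
  have S: "(\<Sum>k=1..n+l. a k) = (\<Sum>k=1..n. a k) + (\<Sum>k\<in>{n<..n+l}. a k)"
    unfolding un by (rule sum.union_disjoint) auto
  have P: "(\<Prod>k=1..n+l. a k) = (\<Prod>k=1..n. a k) * (\<Prod>k\<in>{n<..n+l}. a k)"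
    unfolding un by (rule prod.union_disjoint) auto
  have "(\<Sum>k\<in>{n<..n+l}. a k) \<le> 2 ^ l * (\<Prod>k\<in>{n<..n+l}. a k)"
    using sum_le_2_power_card_mult_prod[of "{n<..n+l}" a] assms by simp
  moreover have "0 \<le> (\<Prod>k=1..n. a k)"
    using assms by (intro prod_nonneg) (meson order.trans zero_le_one)
  ultimately show ?thesis unfolding S P using mult_left_mono by (fastforce simp: mult_ac)
qed

section \<open>Growth of the sums and growth of the products\<close>

lemma large_products_if_superexponential:
  fixes a :: "nat \<Rightarrow> real" and \<phi> :: "real \<Rightarrow> real"
  assumes pos: "\<And>t. 0 < t \<Longrightarrow> 0 < \<phi> t"
    and growth: "limsup (\<lambda>n. ereal (ln (\<phi> (real n)) / real n)) = \<infinity>"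
    and a: "\<And>k. a k \<ge> 1"
    and lim: "(\<lambda>n. (\<Sum>k=1..n. a k) / \<phi> (real n)) \<longlonglongrightarrow> 1"
    and L: "1 \<le> L"
  shows "\<exists>\<^sub>F n in sequentially. L ^ n \<le> (\<Prod>k=1..n. a k)"
proof -
  have "\<exists>\<^sub>F n in sequentially. ln (4 * L) < ln (\<phi> (real n)) / real n"
  proof (rule ccontr)
    assume "\<not> ?thesis"
    then have "\<forall>\<^sub>F n in sequentially. ereal (ln (\<phi> (real n)) / real n) \<le> ereal (ln (4 * L))"
      by (simp add: not_frequently not_less)
    then have "limsup (\<lambda>n. ereal (ln (\<phi> (real n)) / real n)) \<le> ereal (ln (4 * L))"
      by (rule Limsup_bounded)
    then show False using growth by simp
  qed
  moreover have "\<forall>\<^sub>F n in sequentially. ln (4 * L) < ln (\<phi> (real n)) / real n \<longrightarrow>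
      L ^ n \<le> (\<Prod>k=1..n. a k)"
    using order_tendstoD(1)[OF lim, of "1 / 2", simplified] eventually_gt_at_top[of 0]
  proof eventually_elim
    case (elim n)
    show ?case
    proof
      assume "ln (4 * L) < ln (\<phi> (real n)) / real n"
      then have "real n * ln (4 * L) < ln (\<phi> (real n))"
        using elim by (simp add: field_simps)
      then have "ln ((4 * L) ^ n) < ln (\<phi> (real n))"
        using L by (subst ln_realpow) auto
      then have "4 ^ n * L ^ n < \<phi> (real n)"
        using L pos[of "real n"] elim by (simp add: power_mult_distrib)
      also have "\<phi> (real n) \<le> 2 * (\<Sum>k=1..n. a k)"
        using elim pos[of "real n"] by (simp add: field_simps)
      also have "\<dots> \<le> 2 * (2 ^ n * (\<Prod>k=1..n. a k))"
        using sum_le_2_power_card_mult_prod[of "{1..n}" a] a by simp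
      also have "\<dots> \<le> 2 ^ n * (2 ^ n * (\<Prod>k=1..n. a k))"
        using elim a by (intro mult_right_mono mult_nonneg_nonneg prod_nonneg self_le_power)
          (auto intro: order.trans[OF zero_le_one])
      also have "\<dots> = 4 ^ n * (\<Prod>k=1..n. a k)"
        by (simp flip: mult.assoc power_mult_distrib)
      finally show "L ^ n \<le> (\<Prod>k=1..n. a k)" by simp
    qed
  qed
  ultimately show ?thesis by (rule frequently_rev_mp)
qed

text \<open>
  Passing from \<open>m\<^sup>2\<close> to \<open>(m + 1)\<^sup>2\<close> moves by more than \<open>sqrt (m\<^sup>2)\<close>, so \<open>\<phi>\<close> gains a factor \<open>exp d\<close>
  between consecutive squares.
\<close>
lemma sqrt_growth_lower_bound:
  fixes \<phi> :: "real \<Rightarrow> real"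
  assumes pos: "\<And>t. 0 < t \<Longrightarrow> 0 < \<phi> t"
    and incr: "mono_on {0<..} \<phi>"
    and step: "\<forall>\<^sub>F n in sequentially. d \<le> ln (\<phi> (real n + sqrt (real n))) - ln (\<phi> (real n))"
  obtains C where "C > 0" "\<forall>\<^sub>F m in sequentially. C * exp (d * real m) \<le> \<phi> ((real m)\<^sup>2)"
proof -
  from step obtain m0 :: nat where
    m0: "\<And>n. n \<ge> m0 \<Longrightarrow> d \<le> ln (\<phi> (real n + sqrt (real n))) - ln (\<phi> (real n))"
    unfolding eventually_sequentially by blast
  define m1 where "m1 = Suc m0"
  define C where "C = \<phi> ((real m1)\<^sup>2) / exp (d * real m1)"
  have "C * exp (d * real m) \<le> \<phi> ((real m)\<^sup>2)" if "m \<ge> m1" for m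
    using that
  proof (induction m rule: dec_induct)
    case base
    then show ?case by (simp add: C_def)
  next
    case (step m)
    have m: "real m > 0" and "m0 \<le> m" using step by (auto simp: m1_def)
    then have "m0 \<le> m\<^sup>2" using le_trans[OF _ le_square[of m]] by (simp add: power2_eq_square)
    from m0[OF this] have "d + ln (\<phi> ((real m)\<^sup>2)) \<le> ln (\<phi> ((real m)\<^sup>2 + real m))" by simp
    then have "exp (d + ln (\<phi> ((real m)\<^sup>2))) \<le> exp (ln (\<phi> ((real m)\<^sup>2 + real m)))" by simp
    then have "exp d * \<phi> ((real m)\<^sup>2) \<le> \<phi> ((real m)\<^sup>2 + real m)"
      using m pos[of "(real m)\<^sup>2"] pos[of "(real m)\<^sup>2 + real m"] by (simp add: exp_add add_pos_pos)
    also have "\<dots> \<le> \<phi> ((real (Suc m))\<^sup>2)"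
      using m by (intro mono_onD[OF incr]) (auto simp: power2_eq_square algebra_simps add_pos_pos)
    finally have "exp d * \<phi> ((real m)\<^sup>2) \<le> \<phi> ((real (Suc m))\<^sup>2)" .
    moreover have "exp d * (C * exp (d * real m)) \<le> exp d * \<phi> ((real m)\<^sup>2)"
      using step.IH by (intro mult_left_mono) auto
    ultimately have "exp d * (C * exp (d * real m)) \<le> \<phi> ((real (Suc m))\<^sup>2)" by (rule order.trans[rotated])
    then show ?case by (simp add: distrib_left exp_add mult_ac)
  qed
  moreover have "C > 0" using pos[of "(real m1)\<^sup>2"] by (simp add: C_def m1_def)
  ultimately show ?thesis using that unfolding eventually_sequentially by blast
qed

text \<open>
  If \<open>\<phi>\<close> grows by a fixed factor \<open>E > 1\<close> along a window and \<open>S\<close> is asymptotic to \<open>\<phi>\<close>, then the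
  error of the asymptotics, a small multiple of \<open>\<phi>\<close>, cannot hide the growth: the increment of
  \<open>S\<close> is at least a constant multiple of \<open>\<phi>\<close>.
\<close>
lemma sum_increment_lower_bound:
  fixes S :: "nat \<Rightarrow> real" and \<phi> :: "real \<Rightarrow> real"
  assumes pos: "\<And>t. 0 < t \<Longrightarrow> 0 < \<phi> t"
    and incr: "mono_on {0<..} \<phi>"
    and lim: "(\<lambda>n. S n / \<phi> (real n)) \<longlonglongrightarrow> 1"
    and eps: "\<epsilon> > 0" and \<delta>: "\<delta> > 0"
    and step: "\<forall>\<^sub>F n in sequentially. \<delta> \<le> ln (\<phi> (real n + \<epsilon> * sqrt (real n))) - ln (\<phi> (real n))"
  obtains c where "c > 0"
    "\<forall>\<^sub>F n in sequentially. \<forall>l. \<epsilon> * sqrt (real n) \<le> real l \<longrightarrow> c * \<phi> (real n) \<le> S (n + l) - S n"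
proof -
  define E where "E = exp \<delta>"
  have E: "E > 1" using \<delta> by (simp add: E_def)
  (* This value of \<gamma> makes (1 - \<gamma>) E - (1 + \<gamma>), the constant that the estimate below
     produces, equal to (E - 1) / 2. *)
  define \<gamma> where "\<gamma> = (E - 1) / (2 * (E + 1))"
  have \<gamma>: "0 < \<gamma>" "\<gamma> < 1" using E by (auto simp: \<gamma>_def field_simps)
  have "\<forall>\<^sub>F n in sequentially. dist (S n / \<phi> (real n)) 1 < \<gamma>" using lim \<gamma>(1) by (rule tendstoD)
  then obtain n0 where n0: "\<And>n. n \<ge> n0 \<Longrightarrow> \<bar>S n / \<phi> (real n) - 1\<bar> < \<gamma>"
    unfolding eventually_sequentially dist_real_def by blast
  have S: "(1 - \<gamma>) * \<phi> (real n) \<le> S n" "S n \<le> (1 + \<gamma>) * \<phi> (real n)"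
    if "n \<ge> n0" "n > 0" for n
  proof -
    have "1 - \<gamma> \<le> S n / \<phi> (real n)" "S n / \<phi> (real n) \<le> 1 + \<gamma>"
      using n0[OF that(1)] by (auto simp: abs_if split: if_splits)
    then show "(1 - \<gamma>) * \<phi> (real n) \<le> S n" "S n \<le> (1 + \<gamma>) * \<phi> (real n)"
      using pos[of "real n"] that by (auto simp: field_simps)
  qed
  have "\<forall>\<^sub>F n in sequentially. \<forall>l. \<epsilon> * sqrt (real n) \<le> real l \<longrightarrow>
      (E - 1) / 2 * \<phi> (real n) \<le> S (n + l) - S n"
    using step eventually_ge_at_top[of n0] eventually_gt_at_top[of 0]
  proof eventually_elim
    case (elim n)
    show ?case
    proof (intro allI impI)
      fix l assume l: "\<epsilon> * sqrt (real n) \<le> real l"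
      let ?u = "real n + \<epsilon> * sqrt (real n)"
      have n: "real n > 0" using elim by simp
      have u: "?u > 0" using n eps by (intro add_pos_pos mult_pos_pos) auto
      have "exp (\<delta> + ln (\<phi> (real n))) \<le> exp (ln (\<phi> ?u))" using elim by simp
      then have "E * \<phi> (real n) \<le> \<phi> ?u"
        using pos[OF n] pos[OF u] by (simp add: exp_add E_def)
      also have "\<dots> \<le> \<phi> (real (n + l))"
        using l u n by (intro mono_onD[OF incr]) auto
      finally have "(1 - \<gamma>) * (E * \<phi> (real n)) \<le> (1 - \<gamma>) * \<phi> (real (n + l))"
        using \<gamma> by (intro mult_left_mono) auto
      also have "\<dots> \<le> S (n + l)" using elim by (intro S) auto
      finally have "(1 - \<gamma>) * (E * \<phi> (real n)) - (1 + \<gamma>) * \<phi> (real n) \<le> S (n + l) - S n"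
        using S(2)[of n] elim by simp
      also have "(1 - \<gamma>) * (E * \<phi> (real n)) - (1 + \<gamma>) * \<phi> (real n)
          = ((E - 1) - \<gamma> * (E + 1)) * \<phi> (real n)"
        by (simp add: algebra_simps)
      also have "\<gamma> * (E + 1) = (E - 1) / 2" using E by (simp add: \<gamma>_def field_simps)
      finally show "(E - 1) / 2 * \<phi> (real n) \<le> S (n + l) - S n" by (simp add: field_simps)
    qed
  qed
  moreover have "(E - 1) / 2 > 0" using E by simp
  ultimately show ?thesis using that by blast
qed

text \<open>
  The constants: with \<open>N = (K q)\<^sup>2\<close>, the indices between \<open>N\<close> and \<open>3N\<close> are split into \<open>J = K\<^sup>2 q\<close>
  windows of length \<open>2q\<close>.  This is long enough for \<open>\<epsilon> = 1/K\<close>, because \<open>sqrt (3N) \<le> 2Kq\<close>.  If every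
  window multiplies the product of the coefficients by at least \<open>L\<^sup>3\<^sup>q\<close>, the product up to \<open>3N\<close> is
  at least \<open>L\<^sup>3\<^sup>q\<^sup>J = L\<^sup>3\<^sup>N\<close>.  A window does so when \<open>c \<phi>(N) \<ge> 4\<^sup>q L\<^sup>3\<^sup>q\<close>, and \<open>\<phi>(N) \<ge> C exp(dK)\<^sup>q\<close>;
  so \<open>exp(dK) \<ge> 8 L\<^sup>3\<close> suffices, the remaining factor \<open>2\<^sup>q\<close> absorbing the constants \<open>c\<close> and \<open>C\<close>.
\<close>
lemma large_products_if_sqrt_growth:
  fixes a :: "nat \<Rightarrow> real" and \<phi> :: "real \<Rightarrow> real"
  assumes pos: "\<And>t. 0 < t \<Longrightarrow> 0 < \<phi> t"
    and incr: "mono_on {0<..} \<phi>"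
    and growth: "\<And>\<epsilon>. \<epsilon> > 0 \<Longrightarrow> \<exists>\<delta>>0. \<forall>\<^sub>F n in sequentially.
           \<delta> \<le> ln (\<phi> (real n + \<epsilon> * sqrt (real n))) - ln (\<phi> (real n))"
    and a: "\<And>k. a k \<ge> 1"
    and lim: "(\<lambda>n. (\<Sum>k=1..n. a k) / \<phi> (real n)) \<longlonglongrightarrow> 1"
    and L: "1 \<le> L"
  shows "\<exists>\<^sub>F n in sequentially. L ^ n \<le> (\<Prod>k=1..n. a k)"
proof -
  let ?S = "\<lambda>n. \<Sum>k=1..n. a k" and ?P = "\<lambda>n. \<Prod>k=1..n. a k"
  obtain d where "d > 0"
    and d: "\<forall>\<^sub>F n in sequentially. d \<le> ln (\<phi> (real n + sqrt (real n))) - ln (\<phi> (real n))"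
    using growth[of 1] by auto
  obtain C where C: "C > 0"
    and "\<forall>\<^sub>F m in sequentially. C * exp (d * real m) \<le> \<phi> ((real m)\<^sup>2)"
    by (rule sqrt_growth_lower_bound[OF _ incr d]) (erule pos, blast)
  then obtain m0 where m0: "\<And>m. m \<ge> m0 \<Longrightarrow> C * exp (d * real m) \<le> \<phi> ((real m)\<^sup>2)"
    unfolding eventually_sequentially by blast
  obtain K0 :: nat where K0: "ln (8 * L ^ 3) / d < real K0" using reals_Archimedean2 by blast
  define K where "K = Suc K0"
  have "ln (8 * L ^ 3) \<le> d * real K" using K0 \<open>d > 0\<close> by (simp add: K_def field_simps)
  then have "exp (ln (8 * L ^ 3)) \<le> exp (d * real K)" by simp
  then have K: "8 * L ^ 3 \<le> exp (d * real K)" using L by simp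
  have K1: "K \<ge> 1" by (simp add: K_def)
  have Kinv: "1 / real K > 0" using K1 by simp
  obtain \<delta> where \<delta>: "\<delta> > 0" and step: "\<forall>\<^sub>F n in sequentially.
      \<delta> \<le> ln (\<phi> (real n + 1 / real K * sqrt (real n))) - ln (\<phi> (real n))"
    using growth[of "1 / real K"] K1 by auto
  obtain c where c: "c > 0"
    and "\<forall>\<^sub>F n in sequentially. \<forall>l. 1 / real K * sqrt (real n) \<le> real l \<longrightarrow>
        c * \<phi> (real n) \<le> ?S (n + l) - ?S n"
    by (rule sum_increment_lower_bound[OF _ incr lim Kinv \<delta> step]) (erule pos, blast)
  then obtain n1 where n1: "\<And>n l. n \<ge> n1 \<Longrightarrow> 1 / real K * sqrt (real n) \<le> real l \<Longrightarrow>
        c * \<phi> (real n) \<le> ?S (n + l) - ?S n"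
    unfolding eventually_sequentially by blast
  obtain q0 where q0: "1 / (c * C) < 2 ^ q0" using real_arch_pow[of 2] by auto
  show ?thesis unfolding frequently_sequentially
  proof
    fix N0 :: nat
    define q where "q = Max {1, N0, m0, n1, q0}"
    have q: "q \<ge> 1" "q \<ge> N0" "q \<ge> m0" "q \<ge> n1" "q \<ge> q0" by (auto simp: q_def)
    define N where "N = (K * q)\<^sup>2"
    define J where "J = K * K * q"
    have Kq: "q \<le> K * q" using K1 by simp
    also have "K * q \<le> N" unfolding N_def power2_eq_square by (rule le_square)
    finally have qN: "q \<le> N" .
    have JN: "J * (2 * q) = 2 * N" by (simp add: J_def N_def power2_eq_square)
    have N0: "real N > 0" using qN q by simp
    have phiN: "C * exp (d * real (K * q)) \<le> \<phi> (real N)"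
      using m0[of "K * q"] Kq q by (simp add: N_def)
    have window: "c * \<phi> (real N) \<le> ?S (n + 2 * q) - ?S n" if n: "N \<le> n" "n \<le> 3 * N" for n
    proof -
      have "real n \<le> 3 * real N" using n by simp
      also have "\<dots> \<le> (real K * (2 * real q))\<^sup>2" by (simp add: N_def power_mult_distrib)
      finally have "sqrt (real n) \<le> real K * (2 * real q)"
        using real_le_lsqrt by simp
      then have "c * \<phi> (real n) \<le> ?S (n + 2 * q) - ?S n"
        using n qN q K1 by (intro n1) (auto simp: field_simps)
      moreover have "\<phi> (real N) \<le> \<phi> (real n)"
        using n N0 by (intro mono_onD[OF incr]) auto
      ultimately show ?thesis using c by (meson mult_le_cancel_left_pos order.trans)
    qed
    have P1: "?P n \<ge> 1" for n using a by (intro prod_ge_1) auto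
    have base: "L ^ (3 * q) * 2 ^ (2 * q) \<le> c * \<phi> (real N)"
    proof -
      have "1 \<le> c * C * 2 ^ q0" using q0 c C by (simp add: field_simps)
      also have "\<dots> \<le> c * C * 2 ^ q" using c C q by (intro mult_left_mono power_increasing) auto
      finally have absorb: "(8 * L ^ 3) ^ q * 1 \<le> (8 * L ^ 3) ^ q * (c * C * 2 ^ q)"
        using L by (intro mult_left_mono) auto
      have "2 ^ q * (L ^ (3 * q) * 2 ^ (2 * q)) \<le> 2 ^ q * (c * (C * (8 * L ^ 3) ^ q))"
      proof -
        have "(8::real) ^ q = 2 ^ q * 2 ^ (2 * q)" by (simp add: power_mult flip: power_mult_distrib)
        then have "(8 * L ^ 3) ^ q = 2 ^ q * (L ^ (3 * q) * 2 ^ (2 * q))"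
          by (simp add: power_mult_distrib power_mult)
        then show ?thesis
          using absorb by (simp add: mult_ac)
      qed
      then have "L ^ (3 * q) * 2 ^ (2 * q) \<le> c * (C * (8 * L ^ 3) ^ q)" by simp
      also have "\<dots> \<le> c * (C * exp (d * real K) ^ q)"
        using K L c C by (intro mult_left_mono power_mono) auto
      also have "exp (d * real K) ^ q = exp (d * real (K * q))"
        by (simp add: exp_of_nat_mult[symmetric] mult_ac)
      also have "c * (C * exp (d * real (K * q))) \<le> c * \<phi> (real N)"
        using phiN c by (intro mult_left_mono) auto
      finally show ?thesis .
    qed
    have "L ^ (3 * q * j) \<le> ?P (N + j * (2 * q))" if "j \<le> J" for j
      using that
    proof (induction j)
      case 0
      then show ?case using P1[of N] by simp
    next
      case (Suc j)
      let ?n = "N + j * (2 * q)"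
      have "j * (2 * q) \<le> J * (2 * q)" using Suc.prems by (intro mult_right_mono) auto
      then have "?n \<le> 3 * N" using JN by simp
      then have "L ^ (3 * q) * 2 ^ (2 * q) \<le> ?S (?n + 2 * q) - ?S ?n"
        using window[of ?n] base by simp
      then have "L ^ (3 * q * j) * (L ^ (3 * q) * 2 ^ (2 * q)) \<le> ?P ?n * (?S (?n + 2 * q) - ?S ?n)"
        using Suc P1[of ?n] L by (intro mult_mono) auto
      also have "\<dots> \<le> 2 ^ (2 * q) * ?P (?n + 2 * q)" by (rule prod_mult_sum_diff_le[OF a])
      finally have "L ^ (3 * q * j) * L ^ (3 * q) \<le> ?P (?n + 2 * q)" by (simp add: mult_ac)
      then show ?case by (simp add: power_add[symmetric] algebra_simps)
    qed
    from this[of J] have "L ^ (3 * q * J) \<le> ?P (3 * N)" using JN by simp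
    moreover have "3 * q * J = 3 * N" by (simp add: J_def N_def power2_eq_square)
    ultimately have "L ^ (3 * N) \<le> ?P (3 * N)" by simp
    moreover have "3 * N \<ge> N0" using q qN by simp
    ultimately show "\<exists>n\<ge>N0. L ^ n \<le> ?P n" by blast
  qed
qed

theorem theorem5:
  fixes \<phi> :: "real \<Rightarrow> real"
  assumes pos: "\<And>t. 0 < t \<Longrightarrow> 0 < \<phi> t"
    and incr: "mono_on {0<..} \<phi>"
    and superlinear: "filterlim (\<lambda>n. \<phi> (real n) / real n) at_top sequentially"
  shows "((\<forall>\<epsilon>>0. \<exists>\<delta>>0. \<forall>\<^sub>F n in sequentially.
             ln (\<phi> (real n + \<epsilon> * sqrt (real n))) - ln (\<phi> (real n)) \<ge> \<delta>)
           \<longrightarrow> hausdorff_dim (cf_sum_asymp_set \<phi>) \<le> ereal (1 / 2))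
       \<and> (limsup (\<lambda>n. ereal (ln (\<phi> (real n)) / real n)) = \<infinity>
           \<longrightarrow> hausdorff_dim (cf_sum_asymp_set \<phi>) \<le> ereal (1 / 2))"
proof -
  let ?A = "cf_sum_asymp_set \<phi>"
  have sub: "?A \<subseteq> irrational_unit" by (auto simp: cf_sum_asymp_set_def)
  have coeff: "real_of_int (cf_coeff k x) \<ge> 1" if "x \<in> ?A" for x k
    using cf_coeff_pos[of x k] that sub by auto
  have lim: "(\<lambda>n. (\<Sum>k=1..n. real_of_int (cf_coeff k x)) / \<phi> (real n)) \<longlonglongrightarrow> 1" if "x \<in> ?A" for x
    using that by (simp add: cf_sum_asymp_set_def cf_sum_def)
  show ?thesis
  proof (intro conjI impI hausdorff_dim_le_half[OF sub])
    fix x L :: real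
    assume growth: "\<forall>\<epsilon>>0. \<exists>\<delta>>0. \<forall>\<^sub>F n in sequentially.
        ln (\<phi> (real n + \<epsilon> * sqrt (real n))) - ln (\<phi> (real n)) \<ge> \<delta>"
      and x: "x \<in> ?A" and "1 \<le> L"
    then show "\<exists>\<^sub>F n in sequentially. L ^ n \<le> (\<Prod>k=1..n. real_of_int (cf_coeff k x))"
      by (intro large_products_if_sqrt_growth[OF pos incr _ coeff[OF x] lim[OF x]]) auto
  next
    fix x L :: real
    assume "limsup (\<lambda>n. ereal (ln (\<phi> (real n)) / real n)) = \<infinity>" and x: "x \<in> ?A" and "1 \<le> L"
    then show "\<exists>\<^sub>F n in sequentially. L ^ n \<le> (\<Prod>k=1..n. real_of_int (cf_coeff k x))"
      by (intro large_products_if_superexponential[OF pos _ coeff[OF x] lim[OF x]]) auto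
  qed
qed

end
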